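(* Let $\alpha\in[0,1)$, and let $G$ be a connected graph with minimum degree $\delta\geq 2$ and even order $n$ satisfying $$n\geq\begin{cases}7\delta-7, & \text{if } \alpha\in[0,\tfrac{1}{2}];\\ 8\delta-8, & \text{if } \alpha\in(\tfrac{1}{2},\tfrac{2}{3}];\\ \dfrac{3\delta-3}{1-\alpha}, & \text{if } \alpha\in(\tfrac{2}{3},1).\end{cases}$$ If $$\rho_{\alpha}(G)\geq\rho_{\alpha}\bigl(K_{\delta}\vee(K_{n-2\delta+1}\cup(\delta-1)K_{1})\bigr),$$ then $G$ contains an even factor, unless $G\cong K_{\delta}\vee(K_{n-2\delta+1}\cup(\delta-1)K_{1})$.
   Context: All graphs are finite, undirected and simple. The order of $G$ is $n=|V(G)|$, and the minimum degree of $G$ is $\delta=\delta(G)$. An even factor of $G$ is a spanning subgraph $F$ of $G$ (i.e. $V(F)=V(G)$) in which every vertex has nonzero even degree. For $\alpha\in[0,1]$, the $A_\alpha$-matrix of $G$ is $A_{\alpha}(G)=\alpha D(G)+(1-\alpha)A(G)$, where $A(G)$ is the adjacency matrix and $D(G)$ is the diagonal matrix of vertex degrees. The $A_\alpha$-spectral radius $\rho_\alpha(G)$ is the largest eigenvalue of $A_\alpha(G)$. $K_m$ is the complete graph on $m$ vertices; $G_1\cup G_2$ is the disjoint union of two vertex-disjoint graphs; $kH$ is the disjoint union of $k$ copies of $H$; the join $G_1\vee G_2$ is obtained from $G_1\cup G_2$ by joining every vertex of $G_1$ to every vertex of $G_2$ by an edge. *)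

theory Defs
  imports "Graph_Theory.Graph_Theory" "Jordan_Normal_Form.Spectral_Radius"
begin

text \<open>
  A finite simple undirected graph is a \<open>pair_graph\<close>: a finite, loop-free, symmetric set of
  arcs, each edge \<open>uv\<close> being the two arcs \<open>(u,v)\<close> and \<open>(v,u)\<close>.  The degree of a vertex is
  therefore its out-degree.
\<close>

abbreviation vdegree :: "'a pair_pre_digraph \<Rightarrow> 'a \<Rightarrow> nat" where
  "vdegree G v \<equiv> out_degree (with_proj G) v"

definition min_degree :: "'a pair_pre_digraph \<Rightarrow> nat" where
  "min_degree G = Min (vdegree G ` pverts G)"

definition even_factor :: "'a pair_pre_digraph \<Rightarrow> 'a pair_pre_digraph \<Rightarrow> bool" where
  "even_factor F G \<longleftrightarrow> pair_graph F \<and> spanning (with_proj F) (with_proj G) \<and>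
     (\<forall>v \<in> pverts F. vdegree F v \<noteq> 0 \<and> even (vdegree F v))"


definition complete_graph :: "nat \<Rightarrow> nat pair_pre_digraph" where
  "complete_graph m = \<lparr> pverts = {..<m}, parcs = {(i, j). i < m \<and> j < m \<and> i \<noteq> j} \<rparr>"

definition disjoint_union ::
  "'a pair_pre_digraph \<Rightarrow> 'b pair_pre_digraph \<Rightarrow> ('a + 'b) pair_pre_digraph" where
  "disjoint_union G H = \<lparr> pverts = Inl ` pverts G \<union> Inr ` pverts H,
     parcs = map_prod Inl Inl ` parcs G \<union> map_prod Inr Inr ` parcs H \<rparr>"

definition copies :: "nat \<Rightarrow> 'a pair_pre_digraph \<Rightarrow> (nat \<times> 'a) pair_pre_digraph" where
  "copies k H = \<lparr> pverts = {..<k} \<times> pverts H,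
     parcs = {((i, u), (j, v)). i < k \<and> i = j \<and> (u, v) \<in> parcs H} \<rparr>"

definition graph_join ::
  "'a pair_pre_digraph \<Rightarrow> 'b pair_pre_digraph \<Rightarrow> ('a + 'b) pair_pre_digraph" where
  "graph_join G H = \<lparr> pverts = pverts (disjoint_union G H),
     parcs = parcs (disjoint_union G H) \<union> Inl ` pverts G \<times> Inr ` pverts H
               \<union> Inr ` pverts H \<times> Inl ` pverts G \<rparr>"


text \<open>
  The matrices are indexed by a list \<open>xs\<close> enumerating the vertices.  The radius uses an
  arbitrary enumeration; lemma \<open>A_alpha_spectrum\<close> below shows that the choice is immaterial.
\<close>

definition vertex_enum :: "'a pair_pre_digraph \<Rightarrow> 'a list" where
  "vertex_enum G = (SOME xs. distinct xs \<and> set xs = pverts G)"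

definition adjacency_matrix :: "'a list \<Rightarrow> 'a pair_pre_digraph \<Rightarrow> real mat" where
  "adjacency_matrix xs G = Matrix.mat (length xs) (length xs)
     (\<lambda>(i, j). if (xs ! i, xs ! j) \<in> parcs G then 1 else 0)"

definition degree_matrix :: "'a list \<Rightarrow> 'a pair_pre_digraph \<Rightarrow> real mat" where
  "degree_matrix xs G = Matrix.mat (length xs) (length xs)
     (\<lambda>(i, j). if i = j then real (vdegree G (xs ! i)) else 0)"

definition A_alpha :: "real \<Rightarrow> 'a list \<Rightarrow> 'a pair_pre_digraph \<Rightarrow> real mat" where
  "A_alpha \<alpha> xs G = \<alpha> \<cdot>\<^sub>m degree_matrix xs G + (1 - \<alpha>) \<cdot>\<^sub>m adjacency_matrix xs G"

text \<open>
  The \<open>A_alpha\<close> matrix of a graph is real symmetric, so all its eigenvalues are real and the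
  maximum of its real spectrum is its largest eigenvalue.
\<close>

definition rho_alpha :: "real \<Rightarrow> 'a pair_pre_digraph \<Rightarrow> real" where
  "rho_alpha \<alpha> G = Max (spectrum (A_alpha \<alpha> (vertex_enum G) G))"


lemma vertex_enum:
  assumes "finite (pverts G)"
  shows "distinct (vertex_enum G)" "set (vertex_enum G) = pverts G"
proof -
  have "\<exists>xs. distinct xs \<and> set xs = pverts G"
    using finite_distinct_list[OF assms] by blast
  then have "distinct (vertex_enum G) \<and> set (vertex_enum G) = pverts G"
    unfolding vertex_enum_def by (rule someI_ex)
  then show "distinct (vertex_enum G)" "set (vertex_enum G) = pverts G" by auto
qed

lemma A_alpha_mult:
  assumes "distinct xs" "set xs = pverts G" "v \<in> carrier_vec (length xs)"
    and f: "\<And>i. i < length xs \<Longrightarrow> f (xs ! i) = v $ i" and i: "i < length xs"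
  shows "(A_alpha \<alpha> xs G *\<^sub>v v) $ i = \<alpha> * vdegree G (xs ! i) * f (xs ! i)
           + (1 - \<alpha>) * (\<Sum>w \<in> {w \<in> pverts G. (xs ! i, w) \<in> parcs G}. f w)"
proof -
  let ?n = "length xs"
  have nb: "(\<Sum>j<?n. if (xs ! i, xs ! j) \<in> parcs G then f (xs ! j) else 0)
      = (\<Sum>w \<in> {w \<in> pverts G. (xs ! i, w) \<in> parcs G}. f w)"
  proof -
    have "(\<Sum>j<?n. if (xs ! i, xs ! j) \<in> parcs G then f (xs ! j) else 0)
        = (\<Sum>w\<in>pverts G. if (xs ! i, w) \<in> parcs G then f w else 0)"
      by (rule sum.reindex_bij_betw[OF bij_betw_nth[OF assms(1) refl assms(2)[symmetric]]])
    also have "\<dots> = (\<Sum>w \<in> {w \<in> pverts G. (xs ! i, w) \<in> parcs G}. f w)"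
      using assms(2) by (intro sum.inter_filter[symmetric]) (metis List.finite_set)
    finally show ?thesis .
  qed
  have "(A_alpha \<alpha> xs G *\<^sub>v v) $ i = (\<Sum>j<?n. A_alpha \<alpha> xs G $$ (i, j) * v $ j)"
    using i assms(3) by (auto simp: scalar_prod_def A_alpha_def degree_matrix_def
        adjacency_matrix_def lessThan_atLeast0 intro!: sum.cong)
  also have "\<dots> = (\<Sum>j<?n. (if i = j then \<alpha> * vdegree G (xs ! i) * f (xs ! i) else 0)
      + (1 - \<alpha>) * (if (xs ! i, xs ! j) \<in> parcs G then f (xs ! j) else 0))"
    using i f by (intro sum.cong)
      (auto simp: A_alpha_def degree_matrix_def adjacency_matrix_def algebra_simps)
  also have "\<dots> = \<alpha> * vdegree G (xs ! i) * f (xs ! i)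
      + (1 - \<alpha>) * (\<Sum>w \<in> {w \<in> pverts G. (xs ! i, w) \<in> parcs G}. f w)"
    using i by (simp add: sum.distrib nb sum_distrib_left[symmetric])
  finally show ?thesis .
qed

lemma A_alpha_spectrum:
  assumes "distinct xs" "set xs = pverts G"
  shows "spectrum (A_alpha \<alpha> xs G) =
    {k. \<exists>f. (\<exists>u \<in> pverts G. f u \<noteq> 0) \<and>
        (\<forall>u \<in> pverts G. \<alpha> * vdegree G u * f u
            + (1 - \<alpha>) * (\<Sum>w \<in> {w \<in> pverts G. (u, w) \<in> parcs G}. f w) = k * f u)}"
    (is "?L = {k. \<exists>f. ?R k f}")
proof -
  let ?n = "length xs"
  have dim: "dim_row (A_alpha \<alpha> xs G) = ?n"
    by (simp add: A_alpha_def adjacency_matrix_def)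
  have ball: "(\<forall>u \<in> pverts G. P u) \<longleftrightarrow> (\<forall>i<?n. P (xs ! i))" for P
    using assms(2) by (auto simp: all_set_conv_all_nth[symmetric])
  have bex: "(\<exists>u \<in> pverts G. P u) \<longleftrightarrow> (\<exists>i<?n. P (xs ! i))" for P
    using ball[of "\<lambda>u. \<not> P u"] by blast
  have ev: "eigenvector (A_alpha \<alpha> xs G) v k \<longleftrightarrow> ?R k f"
    if v: "v \<in> carrier_vec ?n" and f: "\<And>i. i < ?n \<Longrightarrow> f (xs ! i) = v $ i" for v f k
  proof -
    have nz: "v \<noteq> 0\<^sub>v ?n \<longleftrightarrow> (\<exists>u \<in> pverts G. f u \<noteq> 0)"
      unfolding bex using v f by (auto simp: vec_eq_iff)
    have eq: "A_alpha \<alpha> xs G *\<^sub>v v = k \<cdot>\<^sub>v v \<longleftrightarrow>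
        (\<forall>i<?n. (A_alpha \<alpha> xs G *\<^sub>v v) $ i = k * f (xs ! i))"
      using v f dim by (auto simp: vec_eq_iff simp del: index_mult_mat_vec)
    show ?thesis
      unfolding eigenvector_def dim ball nz eq using v A_alpha_mult[OF assms v f] by auto
  qed
  have "eigenvalue (A_alpha \<alpha> xs G) k \<longleftrightarrow> (\<exists>f. ?R k f)" for k
  proof
    assume "eigenvalue (A_alpha \<alpha> xs G) k"
    then obtain v where e: "eigenvector (A_alpha \<alpha> xs G) v k" unfolding eigenvalue_def by blast
    then have v: "v \<in> carrier_vec ?n" unfolding eigenvector_def dim by blast
    have "the_inv_into {..<?n} ((!) xs) (xs ! i) = i" if "i < ?n" for i
      using that assms(1) by (intro the_inv_into_f_f) (auto simp: inj_on_nth)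
    then have "?R k (\<lambda>u. v $ the_inv_into {..<?n} ((!) xs) u)"
      using e ev[OF v, of "\<lambda>u. v $ the_inv_into {..<?n} ((!) xs) u" k] by simp
    then show "\<exists>f. ?R k f" by (rule exI[where P = "?R k"])
  next
    assume "\<exists>f. ?R k f"
    then obtain f where "?R k f" by blast
    then have "eigenvector (A_alpha \<alpha> xs G) (vec ?n (\<lambda>i. f (xs ! i))) k"
      by (subst ev[of _ f]) simp_all
    then show "eigenvalue (A_alpha \<alpha> xs G) k" unfolding eigenvalue_def by blast
  qed
  then show ?thesis unfolding spectrum_def by auto
qed

end

theory Submission
  imports Defs
begin

text \<open>
  The comparison graph properly contains \<open>K_(n-\<delta>+1)\<close>, so its radius exceeds \<open>n - \<delta>\<close>; as the
  radius of \<open>G\<close> is at most the maximum degree, some vertex \<open>v\<close> misses at most \<open>\<delta> - 2\<close> others.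
  Such a \<open>v\<close> alone yields an even factor.  Let \<open>N\<close> be the neighbourhood of \<open>v\<close> and \<open>W\<close> the set
  of its non-neighbours.  Counting degrees, \<open>G[N]\<close> has no isolated vertex and every vertex
  of \<open>W\<close> has two neighbours in \<open>N\<close>.  Take \<open>G[N]\<close> with two edges from each vertex of \<open>W\<close> to
  \<open>N\<close>, delete an edge of \<open>G[N]\<close> if all degrees are now even, and join \<open>v\<close> to the vertices of odd
  degree.  In particular the exceptional case of the theorem never occurs.
\<close>

section \<open>Parity of degree sums, and even factors given by symmetric arc sets\<close>

text \<open>Off the diagonal, arcs come in pairs \<open>(a, b)\<close>, \<open>(b, a)\<close>;
  removing one pair keeps the relation symmetric and irreflexive and lowers the cardinality by
  two.\<close>

lemma even_card_sym_irrefl: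
  assumes "finite R" "sym R" "irrefl R"
  shows "even (card R)"
  using assms
proof (induction R rule: finite_psubset_induct)
  case (psubset R)
  show ?case
  proof (cases "R = {}")
    case False
    then obtain a b where ab: "(a, b) \<in> R" by auto
    then have ne: "a \<noteq> b" and ba: "(b, a) \<in> R"
      using psubset.prems by (auto simp: irrefl_def sym_def)
    let ?S = "R - {(a, b), (b, a)}"
    have "even (card ?S)"
      using psubset.prems ab by (intro psubset.IH) (auto simp: sym_def irrefl_def)
    moreover have "card R = card ?S + 2"
    proof -
      have "card {(a, b), (b, a)} = 2" using ne by simp
      moreover have "card ?S = card R - card {(a, b), (b, a)}"
        using ab ba by (intro card_Diff_subset) auto
      moreover have "card {(a, b), (b, a)} \<le> card R"
        using ab ba psubset.hyps by (intro card_mono) auto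
      ultimately show ?thesis by linarith
    qed
    ultimately show ?thesis by simp
  qed simp
qed

lemma vdegree_eq_card: "vdegree G u = card {w. (u, w) \<in> parcs G}"
proof -
  have "out_arcs (with_proj G) u = Pair u ` {w. (u, w) \<in> parcs G}"
    by (auto simp: out_arcs_def)
  then show ?thesis
    by (simp add: out_degree_def card_image inj_on_def)
qed

text \<open>Handshake argument: the sum counts the arcs of \<open>R\<close> by their tails.\<close>

lemma even_degree_sum:
  assumes "finite V" "finite R" "sym R" "irrefl R" "R \<subseteq> V \<times> V"
  shows "even (\<Sum>u\<in>V. card {w. (u, w) \<in> R})"
proof -
  have fin: "finite {w. (u, w) \<in> R}" for u
    by (rule finite_subset[of _ "snd ` R"]) (use assms(2) in \<open>force+\<close>)
  have "R = Sigma V (\<lambda>u. {w. (u, w) \<in> R})" using assms(5) by auto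
  then have "card R = (\<Sum>u\<in>V. card {w. (u, w) \<in> R})"
    using card_SigmaI[OF assms(1), of "\<lambda>u. {w. (u, w) \<in> R}"] fin by simp
  then show ?thesis using even_card_sym_irrefl[OF assms(2-4)] by simp
qed

lemma pair_graph_arcs:
  assumes "pair_graph G"
  shows "finite (pverts G)" "finite (parcs G)" "sym (parcs G)" "irrefl (parcs G)"
    "parcs G \<subseteq> pverts G \<times> pverts G"
proof -
  interpret pair_graph G by fact
  show "finite (pverts G)" "finite (parcs G)" by auto
  show "sym (parcs G)" using arcs_symmetric by (auto simp: sym_def)
  show "irrefl (parcs G)" using pair_no_loops by (fastforce simp: irrefl_def)
  show "parcs G \<subseteq> pverts G \<times> pverts G"
    using arc_fst_in_verts arc_snd_in_verts by force
qed

lemma pair_graphI: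
  assumes "finite (pverts F)" "sym (parcs F)" "irrefl (parcs F)"
    "parcs F \<subseteq> pverts F \<times> pverts F"
  shows "pair_graph F"
proof
  show "finite (parcs F)" using assms finite_subset by blast
qed (use assms in \<open>auto simp: irrefl_def symmetric_def\<close>)

lemma even_factorI:
  assumes G: "pair_graph G" and R: "R \<subseteq> parcs G" "sym R"
    and deg: "\<And>u. u \<in> pverts G \<Longrightarrow>
      card {w. (u, w) \<in> R} \<noteq> 0 \<and> even (card {w. (u, w) \<in> R})"
  shows "even_factor \<lparr> pverts = pverts G, parcs = R \<rparr> G"
proof -
  let ?F = "\<lparr> pverts = pverts G, parcs = R \<rparr>"
  note Ga = pair_graph_arcs[OF G]
  have F: "pair_graph ?F"
    using Ga R by (intro pair_graphI) (auto simp: irrefl_def)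
  have "pair_wf_digraph G" "pair_wf_digraph ?F"
    using G F by (auto simp: pair_graph_def pair_digraph_def pair_fin_digraph_def)
  then have "spanning (with_proj ?F) (with_proj G)"
    using R by (simp add: spanning_def subgraph_def wf_digraph_wp_iff compatible_def)
  then show ?thesis
    using F deg by (simp add: even_factor_def vdegree_eq_card)
qed

section \<open>An even factor around a vertex of large degree\<close>

lemma even_factor_of_large_degree:
  assumes G: "pair_graph G" and v: "v \<in> pverts G"
    and \<delta>: "\<And>u. u \<in> pverts G \<Longrightarrow> \<delta> \<le> vdegree G u"
    and large: "card (pverts G) < vdegree G v + \<delta>"
  shows "\<exists>F. even_factor F G"
proof -
  define V where "V = pverts G"
  define E where "E = parcs G"
  define nb where "nb R u = {w. (u, w) \<in> R}" for R :: "('a \<times> 'a) set" and u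
  define N where "N = nb E v"
  define W where "W = V - insert v N"
  note Ga = pair_graph_arcs[OF G, folded V_def E_def]
  have fin_nb: "finite (nb R u)" if "R \<subseteq> E" for R u
    by (rule finite_subset[OF _ Ga(1)]) (use that Ga(5) in \<open>auto simp: nb_def\<close>)
  have symE: "(y, x) \<in> E" if "(x, y) \<in> E" for x y
    using that Ga(3) by (auto simp: sym_def)
  have irrE: "(x, x) \<notin> E" for x using Ga(4) by (auto simp: irrefl_def)
  have vN: "v \<notin> N" using irrE by (simp add: N_def nb_def)
  have NV: "N \<subseteq> V" using Ga(5) by (auto simp: N_def nb_def)
  have finN: "finite N" and finW: "finite W"
    using NV Ga(1) finite_subset by (auto simp: W_def)
  have V_eq: "V = insert v (N \<union> W)" using v NV by (auto simp: W_def V_def)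
  have NW: "N \<inter> W = {}" and vW: "v \<notin> W" by (auto simp: W_def)
  have "card V = Suc (card N + card W)"
    using V_eq vN vW NW finN finW by (simp add: card_Un_disjoint)
  \<comment> \<open>This is \<open>large\<close> rewritten: \<open>v\<close> misses at most
    \<open>\<delta> - 2\<close> other vertices. Every later degree count rests on it.\<close>
  then have cW: "card W + 2 \<le> \<delta>"
    using large by (simp add: vdegree_eq_card V_def N_def nb_def E_def)
  have deg: "\<delta> \<le> card (nb E u)" if "u \<in> V" for u
    using \<delta>[of u] that by (simp add: vdegree_eq_card V_def nb_def E_def)

  \<comment> \<open>Otherwise all neighbours of \<open>u\<close> would lie in
    \<open>insert v W\<close>, which has at most \<open>\<delta> - 1\<close> elements.\<close>
  have N_nb: "nb E u \<inter> N \<noteq> {}" if u: "u \<in> N" for u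
  proof
    assume "nb E u \<inter> N = {}"
    then have "nb E u \<subseteq> insert v W"
      using Ga(5) by (auto simp: nb_def V_eq)
    then have "card (nb E u) \<le> Suc (card W)"
      using finW vW by (metis card_insert_disjoint card_mono finite_insert)
    then show False using deg[of u] u NV cW by auto
  qed
  \<comment> \<open>A vertex of \<open>W\<close> is not adjacent to \<open>v\<close>, so at most
    \<open>card W\<close> of its at least \<open>\<delta>\<close> neighbours lie outside
    \<open>N\<close>.\<close>
  have "\<exists>P. P \<subseteq> nb E w \<inter> N \<and> card P = 2" if w: "w \<in> W" for w
  proof -
    have "v \<notin> nb E w"
      using symE[of w v] w by (auto simp: W_def N_def nb_def)
    then have "nb E w \<subseteq> W \<union> (nb E w \<inter> N)"
      using Ga(5) by (auto simp: nb_def V_eq)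
    then have "card (nb E w) \<le> card (W \<union> (nb E w \<inter> N))"
      using finW finN by (intro card_mono) auto
    also have "\<dots> \<le> card W + card (nb E w \<inter> N)" by (rule card_Un_le)
    finally have "2 \<le> card (nb E w \<inter> N)"
      using deg[of w] w cW by (auto simp: W_def)
    then show ?thesis by (metis obtain_subset_with_card_n)
  qed
  then obtain P where P: "\<And>w. w \<in> W \<Longrightarrow> P w \<subseteq> nb E w \<inter> N" "\<And>w. w \<in> W \<Longrightarrow> card (P w) = 2"
    by metis

  \<comment> \<open>\<open>H\<close> is the factor without the edges at \<open>v\<close>. Degrees on
    \<open>W\<close> are already two; an odd vertex of \<open>N\<close> is required so that
    \<open>v\<close> later receives a nonzero degree.\<close>
  have "\<exists>H \<subseteq> E. sym H \<and> v \<notin> Domain H \<and> (\<forall>w\<in>W. nb H w = P w) \<and>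
      (\<forall>u\<in>N. nb H u \<noteq> {}) \<and> (\<exists>u\<in>N. odd (card (nb H u)))"
  proof -
    define Q where "Q = Sigma W P"
    define H where "H = E \<inter> N \<times> N \<union> Q \<union> Q\<inverse>"
    have QE: "Q \<subseteq> E" "Q \<subseteq> W \<times> N" using P(1) by (auto simp: Q_def nb_def)
    have HE: "H \<subseteq> E" using QE symE by (auto simp: H_def)
    have Hsym: "sym H" using symE by (auto simp: H_def sym_def)
    have Hv: "v \<notin> Domain H" using QE vN vW by (auto simp: H_def)
    have HW: "nb H w = P w" if "w \<in> W" for w
      using that QE NW by (auto simp: H_def nb_def Q_def)
    have HN: "nb H u \<noteq> {}" if "u \<in> N" for u
      using N_nb[OF that] that by (auto simp: H_def nb_def)
    show ?thesis
    proof (cases "\<exists>u\<in>N. odd (card (nb H u))")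
      case True
      then show ?thesis using HE Hsym Hv HW HN by (intro exI[of _ H]) auto
    next
      case False
      have "N \<noteq> {}"
        using deg[of v] cW v by (auto simp: V_def N_def)
      then obtain a where a: "a \<in> N" by blast
      then obtain b where b: "b \<in> N" "(a, b) \<in> E" using N_nb by (auto simp: nb_def)
      \<comment> \<open>All degrees on \<open>N\<close> are even and positive here. Dropping an edge
        inside \<open>N\<close> makes exactly its two ends odd, hence still nonzero, and leaves
        \<open>W\<close> untouched.\<close>
      define H' where "H' = H - {(a, b), (b, a)}"
      have ab: "a \<noteq> b" using b irrE by auto
      have abH: "b \<in> nb H a" "a \<in> nb H b" using a b symE by (auto simp: H_def nb_def)
      have nb': "nb H' u = (if u = a then nb H a - {b} else if u = b then nb H b - {a} else nb H u)"
        for u using ab by (auto simp: H'_def nb_def)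
      have odd': "odd (card (nb H' u))" if "u = a \<or> u = b" for u
      proof -
        have "even (card (nb H u))" "card (nb H u) > 0"
          using False HN[of u] a b that fin_nb[OF HE, of u] by (auto simp: card_gt_0_iff)
        then show ?thesis
          using that abH ab nb'[of u] by (auto simp: card_Diff_singleton)
      qed
      have "nb H' u \<noteq> {}" if "u \<in> N" for u
        using odd'[of u] HN[OF that] nb'[of u] by (metis card.empty even_zero)
      moreover have "nb H' w = P w" if "w \<in> W" for w
        using nb'[of w] HW[OF that] that a b NW by auto
      moreover have "sym H'" using Hsym by (auto simp: H'_def sym_def)
      moreover have "H' \<subseteq> E" "v \<notin> Domain H'" using HE Hv by (auto simp: H'_def)
      ultimately show ?thesis using odd'[of a] a by blast
    qed
  qed
  then obtain H where H: "H \<subseteq> E" "sym H" "v \<notin> Domain H" "\<And>w. w \<in> W \<Longrightarrow> nb H w = P w"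
      "\<And>u. u \<in> N \<Longrightarrow> nb H u \<noteq> {}" "\<exists>u\<in>N. odd (card (nb H u))"
    by blast

  define T where "T = {u \<in> N. odd (card (nb H u))}"
  define R where "R = H \<union> {v} \<times> T \<union> T \<times> {v}"
  have TN: "T \<subseteq> N" by (auto simp: T_def)
  have RE: "R \<subseteq> E" using H(1) TN symE by (auto simp: R_def N_def nb_def)
  have Rsym: "sym R" using H(2) by (auto simp: R_def sym_def)
  have vR: "v \<notin> nb H u" for u using H(2,3) by (auto simp: nb_def sym_def)
  have nbv: "nb R v = T" using H(3) vN TN by (auto simp: R_def nb_def)
  have nbu: "nb R u = (if u \<in> T then insert v (nb H u) else nb H u)" if "u \<noteq> v" for u
    using that by (auto simp: R_def nb_def)
  have good: "card (nb R u) \<noteq> 0 \<and> even (card (nb R u))" if "u \<in> N \<union> W" for u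
  proof (cases "u \<in> W")
    case True
    then have "u \<noteq> v" "u \<notin> T" using vW TN NW by auto
    then have "nb R u = P u" using nbu[of u] H(4)[OF True] by simp
    then show ?thesis using P(2)[OF True] by simp
  next
    case False
    then have u: "u \<in> N" using that by auto
    then have "card (nb H u) \<noteq> 0" using H(5) fin_nb[OF H(1), of u] by auto
    moreover have "u \<noteq> v" using u vN by auto
    ultimately show ?thesis
      using u nbu[of u] vR[of u] fin_nb[OF H(1), of u] by (simp add: T_def)
  qed
  \<comment> \<open>The parity at \<open>v\<close> is not visible from \<open>T\<close>; it is
    forced by the handshake argument, since all other degrees are even.\<close>
  have "even (\<Sum>u\<in>V. card (nb R u))"
    unfolding nb_def using Ga Rsym RE
    by (intro even_degree_sum) (auto intro: finite_subset simp: irrefl_def)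
  moreover have "(\<Sum>u\<in>V. card (nb R u)) = card (nb R v) + (\<Sum>u\<in>N \<union> W. card (nb R u))"
    using V_eq vN vW finN finW by simp
  moreover have "even (\<Sum>u\<in>N \<union> W. card (nb R u))"
    using good by (intro dvd_sum) auto
  ultimately have "even (card (nb R v))" by simp
  moreover have "card (nb R v) \<noteq> 0"
    using nbv H(6) finN by (auto simp: T_def)
  ultimately have "card (nb R u) \<noteq> 0 \<and> even (card (nb R u))" if "u \<in> V" for u
    using good[of u] that V_eq by auto
  then show ?thesis
    using even_factorI[OF G RE[unfolded E_def] Rsym] unfolding nb_def V_def by blast
qed

section \<open>The radius is at most the maximum degree\<close>

text \<open>A complex eigenvector exists; symmetry forces its eigenvalue to be real, and then its
  real or imaginary part is a real eigenvector. This guarantees that the \<open>Max\<close> in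
  \<open>rho_alpha\<close> ranges over a nonempty set.\<close>

lemma spectrum_symmetric_real_nonempty:
  fixes A :: "real mat"
  assumes A: "A \<in> carrier_mat n n" and sym: "transpose_mat A = A" and n: "n > 0"
  shows "spectrum A \<noteq> {}"
proof -
  let ?B = "map_mat complex_of_real A"
  have B: "?B \<in> carrier_mat n n" using A by simp
  obtain c v where ev: "eigenvector ?B v c"
    using spectrum_non_empty[OF B n] by (auto simp: spectrum_def eigenvalue_def)
  then have v: "v \<in> carrier_vec n" "v \<noteq> 0\<^sub>v n" "?B *\<^sub>v v = c \<cdot>\<^sub>v v"
    using B by (auto simp: eigenvector_def)
  define a where "a = map_vec Re v"
  define b where "b = map_vec Im v"
  have a: "a \<in> carrier_vec n" and b: "b \<in> carrier_vec n" using v by (auto simp: a_def b_def)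
  have row: "(\<Sum>j<n. complex_of_real (A $$ (i, j)) * v $ j) = c * v $ i" if "i < n" for i
    using arg_cong[OF v(3), of "\<lambda>x. x $ i"] that v(1) A
    by (simp add: scalar_prod_def lessThan_atLeast0)
  have Aa: "A *\<^sub>v a = Re c \<cdot>\<^sub>v a - Im c \<cdot>\<^sub>v b"
  proof (rule eq_vecI)
    fix i assume "i < dim_vec (Re c \<cdot>\<^sub>v a - Im c \<cdot>\<^sub>v b)"
    then have i: "i < n" using b by simp
    then show "(A *\<^sub>v a) $ i = (Re c \<cdot>\<^sub>v a - Im c \<cdot>\<^sub>v b) $ i"
      using arg_cong[OF row[OF i], of Re] v(1) A a b
      by (simp add: scalar_prod_def lessThan_atLeast0 a_def b_def)
  qed (use A b in auto)
  have Ab: "A *\<^sub>v b = Im c \<cdot>\<^sub>v a + Re c \<cdot>\<^sub>v b"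
  proof (rule eq_vecI)
    fix i assume "i < dim_vec (Im c \<cdot>\<^sub>v a + Re c \<cdot>\<^sub>v b)"
    then have i: "i < n" using b by simp
    then show "(A *\<^sub>v b) $ i = (Im c \<cdot>\<^sub>v a + Re c \<cdot>\<^sub>v b) $ i"
      using arg_cong[OF row[OF i], of Im] v(1) A a b
      by (simp add: scalar_prod_def lessThan_atLeast0 a_def b_def algebra_simps)
  qed (use A b in auto)
  \<comment> \<open>Expanding both sides with \<open>Aa\<close> and \<open>Ab\<close>, the terms in
    \<open>Re c\<close> cancel, leaving \<open>Im c\<close> times the squared norm of the
    eigenvector.\<close>
  have "(A *\<^sub>v a) \<bullet> b = a \<bullet> (A *\<^sub>v b)"
    using transpose_vec_mult_scalar[OF A b a] sym a b A
    by (metis comm_scalar_prod mult_mat_vec_carrier)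
  then have "Im c * (a \<bullet> a + b \<bullet> b) = 0"
    unfolding Aa Ab using a b
    by (simp add: minus_scalar_prod_distrib[of _ n] scalar_prod_add_distrib[of _ n] algebra_simps)
  moreover have "a \<bullet> a + b \<bullet> b \<noteq> 0"
  proof
    assume "a \<bullet> a + b \<bullet> b = 0"
    moreover have "a \<bullet> a \<ge> 0" "b \<bullet> b \<ge> 0" by (simp_all add: scalar_prod_def sum_nonneg)
    ultimately have "a \<bullet> a = 0" "b \<bullet> b = 0" by linarith+
    then have "Re (v $ i) = 0 \<and> Im (v $ i) = 0" if "i < n" for i
      using that v(1) by (simp add: a_def b_def scalar_prod_def sum_nonneg_eq_0_iff)
    then show False using v(1,2) by (auto simp: vec_eq_iff complex_eq_iff)
  qed
  ultimately have c: "Im c = 0" by simp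
  have "a \<noteq> 0\<^sub>v n \<or> b \<noteq> 0\<^sub>v n"
    using v(1,2) by (auto simp: a_def b_def vec_eq_iff complex_eq_iff)
  moreover have "A *\<^sub>v a = Re c \<cdot>\<^sub>v a" "A *\<^sub>v b = Re c \<cdot>\<^sub>v b"
    using Aa Ab c a b by auto
  ultimately have "eigenvalue A (Re c)"
    using A a b unfolding eigenvalue_def eigenvector_def by auto
  then show ?thesis by (auto simp: spectrum_def)
qed

lemma A_alpha_carrier: "A_alpha \<alpha> xs G \<in> carrier_mat (length xs) (length xs)"
  by (simp add: A_alpha_def adjacency_matrix_def degree_matrix_def)

text \<open>Row \<open>u\<close> of the matrix is nonnegative with sum the degree of
  \<open>u\<close>. Reading the eigenvalue equation at a vertex where the eigenvector is largest in
  absolute value bounds the eigenvalue by that degree.\<close>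

lemma rho_alpha_le_degree:
  assumes \<alpha>: "0 \<le> \<alpha>" "\<alpha> \<le> 1" and G: "pair_graph G" and ne: "pverts G \<noteq> {}"
  shows "\<exists>u \<in> pverts G. rho_alpha \<alpha> G \<le> vdegree G u"
proof -
  note Ga = pair_graph_arcs[OF G]
  let ?xs = "vertex_enum G"
  let ?A = "A_alpha \<alpha> ?xs G"
  note xs = vertex_enum[OF Ga(1)]
  have "transpose_mat ?A = ?A"
    using Ga(3) by (intro eq_matI)
      (auto simp: A_alpha_def adjacency_matrix_def degree_matrix_def sym_def)
  moreover have "length ?xs > 0" using xs(2) ne by auto
  ultimately have "spectrum ?A \<noteq> {}"
    using spectrum_symmetric_real_nonempty[OF A_alpha_carrier] by blast
  then have "rho_alpha \<alpha> G \<in> spectrum ?A"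
    unfolding rho_alpha_def using card_finite_spectrum(1)[OF A_alpha_carrier] by (intro Max_in)
  then obtain k f where k: "k = rho_alpha \<alpha> G" and nz: "\<exists>u \<in> pverts G. f u \<noteq> (0::real)"
    and eq: "\<And>u. u \<in> pverts G \<Longrightarrow> \<alpha> * vdegree G u * f u
        + (1 - \<alpha>) * (\<Sum>w \<in> {w \<in> pverts G. (u, w) \<in> parcs G}. f w) = k * f u"
    unfolding A_alpha_spectrum[OF xs] by blast
  define M where "M = Max ((\<lambda>u. \<bar>f u\<bar>) ` pverts G)"
  have "M \<in> (\<lambda>u. \<bar>f u\<bar>) ` pverts G" unfolding M_def using Ga(1) ne by (intro Max_in) auto
  then obtain u where u: "u \<in> pverts G" "M = \<bar>f u\<bar>" by auto
  have le: "\<bar>f w\<bar> \<le> \<bar>f u\<bar>" if "w \<in> pverts G" for w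
    unfolding u(2)[symmetric] M_def using Ga(1) that by (intro Max_ge) auto
  have pos: "\<bar>f u\<bar> > 0" using nz le by fastforce
  let ?N = "{w \<in> pverts G. (u, w) \<in> parcs G}"
  have N: "card ?N = vdegree G u"
    unfolding vdegree_eq_card using Ga(5) by (intro arg_cong[where f = card]) auto
  have "\<bar>\<Sum>w \<in> ?N. f w\<bar> \<le> (\<Sum>w \<in> ?N. \<bar>f w\<bar>)" by (rule sum_abs)
  also have "\<dots> \<le> (\<Sum>w \<in> ?N. \<bar>f u\<bar>)" using le by (intro sum_mono) auto
  also have "\<dots> = vdegree G u * \<bar>f u\<bar>" using N by simp
  finally have S: "\<bar>\<Sum>w \<in> ?N. f w\<bar> \<le> vdegree G u * \<bar>f u\<bar>" .
  have "k * \<bar>f u\<bar> \<le> \<bar>k * f u\<bar>" by (simp add: abs_mult mult_right_mono)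
  also have "\<dots> \<le> \<bar>\<alpha> * vdegree G u * f u\<bar> + \<bar>(1 - \<alpha>) * (\<Sum>w \<in> ?N. f w)\<bar>"
    unfolding eq[OF u(1), symmetric] by (rule abs_triangle_ineq)
  also have "\<dots> \<le> \<alpha> * vdegree G u * \<bar>f u\<bar> + (1 - \<alpha>) * (vdegree G u * \<bar>f u\<bar>)"
    using \<alpha> S by (intro add_mono) (auto simp: abs_mult mult_left_mono)
  also have "\<dots> = vdegree G u * \<bar>f u\<bar>" by (simp add: algebra_simps)
  finally show ?thesis using pos u(1) k by auto
qed

section \<open>A lower bound for the radius of the comparison graph\<close>

text \<open>
  The equations say that \<open>(1, y, z)\<close> is an eigenvector of the quotient matrix of
  \<open>K_s \<or> (K_m \<union> t K_1)\<close>; \<open>m + s - 1\<close> is the eigenvalue of its subgraph \<open>K_(m+s)\<close>.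
\<close>

lemma quotient_eigenvalue:
  fixes \<alpha> s m t :: real
  assumes \<alpha>: "0 \<le> \<alpha>" "\<alpha> < 1" and "s \<ge> 1" "m \<ge> 1" "t \<ge> 1"
  obtains k y z where "k > m + s - 1"
    "\<alpha> * (s + m + t - 1) + (1 - \<alpha>) * (s - 1 + m * y + t * z) = k"
    "\<alpha> * (m + s - 1) * y + (1 - \<alpha>) * (s + (m - 1) * y) = k * y"
    "\<alpha> * s * z + (1 - \<alpha>) * s = k * z"
proof -
  define N where "N = m + s - 1"
  \<comment> \<open>For given \<open>k\<close>, \<open>y k\<close> and \<open>z k\<close> solve the
    second and third equations; \<open>g k\<close> is the defect in the first, so a zero of
    \<open>g\<close> beyond \<open>N\<close> is sought.\<close>
  define y where "y k = (1 - \<alpha>) * s / (k - N + (1 - \<alpha>) * s)" for k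
  define z where "z k = (1 - \<alpha>) * s / (k - \<alpha> * s)" for k
  define g where "g k = k - \<alpha> * (s + m + t - 1) - (1 - \<alpha>) * (s - 1 + m * y k + t * z k)" for k
  have p: "(1 - \<alpha>) * s > 0" using assms by simp
  then have "\<alpha> * s < N" using \<open>m \<ge> 1\<close> by (simp add: N_def algebra_simps)
  then have dz: "k - \<alpha> * s > 0" and dy: "k - N + (1 - \<alpha>) * s > 0" if "k \<ge> N" for k
    using that p by linarith+
  have "\<forall>k. N \<le> k \<and> k \<le> N + t \<longrightarrow> isCont g k"
    using dz dy unfolding g_def y_def z_def by (force intro!: continuous_intros)
  \<comment> \<open>At \<open>k = N\<close> the clique part balances exactly since
    \<open>y N = 1\<close>, so only the \<open>t\<close> isolated vertices contribute, with negative
    sign.\<close>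
  moreover have "g N \<le> 0" "g N \<noteq> 0"
  proof -
    have "y N = 1" using p by (auto simp: y_def)
    then have "g N = - (\<alpha> * t + (1 - \<alpha>) * t * z N)"
      by (simp add: g_def N_def algebra_simps)
    moreover have "z N > 0" using dz[of N] p by (simp add: z_def)
    then have "(1 - \<alpha>) * t * z N > 0" using assms by simp
    moreover have "\<alpha> * t \<ge> 0" using assms by simp
    ultimately show "g N \<le> 0" "g N \<noteq> 0" by linarith+
  qed
  \<comment> \<open>\<open>N + t\<close> is the maximum degree of the graph; there both
    \<open>y\<close> and \<open>z\<close> are at most the entry 1 on \<open>K_s\<close>.\<close>
  moreover have "g (N + t) \<ge> 0"
  proof -
    have "y (N + t) \<le> 1" using p dy[of "N + t"] assms by (simp add: y_def)
    moreover have "z (N + t) \<le> 1"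
      using dz[of "N + t"] assms by (simp add: z_def N_def algebra_simps)
    ultimately have "m * y (N + t) \<le> m * 1" "t * z (N + t) \<le> t * 1"
      using assms by (intro mult_left_mono; simp)+
    then have "s - 1 + m * y (N + t) + t * z (N + t) \<le> N + t"
      unfolding N_def by linarith
    then have "(1 - \<alpha>) * (s - 1 + m * y (N + t) + t * z (N + t)) \<le> (1 - \<alpha>) * (N + t)"
      using assms by (intro mult_left_mono) auto
    then show ?thesis by (simp add: g_def N_def algebra_simps)
  qed
  ultimately obtain k where k: "N \<le> k" "k \<le> N + t" "g k = 0"
    using IVT[of g N 0 "N + t"] assms by auto
  \<comment> \<open>The intermediate value theorem only gives \<open>N \<le> k\<close>; this makes
    the bound strict.\<close>
  then have "k \<noteq> N" using \<open>g N \<noteq> 0\<close> by auto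
  moreover have "y k * (k - N + (1 - \<alpha>) * s) = (1 - \<alpha>) * s" "z k * (k - \<alpha> * s) = (1 - \<alpha>) * s"
    using dz[OF k(1)] dy[OF k(1)] by (simp_all add: y_def z_def)
  ultimately show ?thesis
    using k by (intro that[of k "y k" "z k"]) (auto simp: g_def N_def algebra_simps)
qed

lemma mem_map_prod_sum_iff:
  "(Inl a, Inl b) \<in> map_prod Inl Inl ` X \<longleftrightarrow> (a, b) \<in> X"
  "(Inr c, Inr d) \<in> map_prod Inr Inr ` Y \<longleftrightarrow> (c, d) \<in> Y"
  by force+

text \<open>The quotient eigenvector, spread constantly over the three vertex classes, is an
  eigenvector of the whole matrix, so its eigenvalue \<open>k\<close> is a lower bound for the
  radius.\<close>

lemma rho_alpha_join_gt:
  assumes \<alpha>: "0 \<le> \<alpha>" "\<alpha> < 1" and "s \<ge> 1" "m \<ge> 1" "t \<ge> 1"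
  shows "rho_alpha \<alpha> (graph_join (complete_graph s)
           (disjoint_union (complete_graph m) (copies t (complete_graph 1))))
         > real m + real s - 1" (is "rho_alpha \<alpha> ?G > _")
proof -
  obtain k y z where k: "k > real m + real s - 1"
    "\<alpha> * (real s + real m + real t - 1) + (1 - \<alpha>) * (real s - 1 + real m * y + real t * z) = k"
    "\<alpha> * (real m + real s - 1) * y + (1 - \<alpha>) * (real s + (real m - 1) * y) = k * y"
    "\<alpha> * real s * z + (1 - \<alpha>) * real s = k * z"
    using quotient_eigenvalue[OF \<alpha>, of "real s" "real m" "real t"] assms by auto
  \<comment> \<open>The vertices of \<open>K_s\<close>, of \<open>K_m\<close> and of the
    \<open>t\<close> copies of \<open>K_1\<close>; the 0 is the only vertex of
    \<open>complete_graph 1\<close>.\<close>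
  define A B C where "A = (Inl ` {..<s} :: (nat + nat + nat \<times> nat) set)"
    and "B = (Inr ` Inl ` {..<m} :: (nat + nat + nat \<times> nat) set)"
    and "C = (Inr ` Inr ` ({..<t} \<times> {0}) :: (nat + nat + nat \<times> nat) set)"
  define f :: "nat + nat + nat \<times> nat \<Rightarrow> real"
    where "f = case_sum (\<lambda>_. 1) (case_sum (\<lambda>_. y) (\<lambda>_. z))"
  note defs = complete_graph_def disjoint_union_def graph_join_def copies_def
  have V: "pverts ?G = A \<union> B \<union> C"
    by (auto simp: defs A_def B_def C_def image_Un image_image)
  have fin: "finite A" "finite B" "finite C" by (auto simp: A_def B_def C_def)
  have disj: "A \<inter> B = {}" "A \<inter> C = {}" "B \<inter> C = {}" by (auto simp: A_def B_def C_def)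
  have card: "card A = s" "card B = m" "card C = t"
    by (auto simp: A_def B_def C_def card_image inj_on_def)
  have fA: "f u = 1" if "u \<in> A" for u using that by (auto simp: A_def f_def)
  have fB: "f u = y" if "u \<in> B" for u using that by (auto simp: B_def f_def)
  have fC: "f u = z" if "u \<in> C" for u using that by (auto simp: C_def f_def)
  have nb: "{w. (u, w) \<in> parcs ?G} =
      (if u \<in> A then (A - {u}) \<union> B \<union> C else if u \<in> B then A \<union> (B - {u}) else A)"
    if "u \<in> A \<union> B \<union> C" for u
    using that by (auto simp: defs A_def B_def C_def mem_map_prod_sum_iff)
  have nbV: "{w \<in> pverts ?G. (u, w) \<in> parcs ?G} = {w. (u, w) \<in> parcs ?G}"
    if "u \<in> A \<union> B \<union> C" for u
    using nb[OF that] V by auto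
  have eq: "\<alpha> * vdegree ?G u * f u
      + (1 - \<alpha>) * (\<Sum>w \<in> {w \<in> pverts ?G. (u, w) \<in> parcs ?G}. f w) = k * f u"
    if u: "u \<in> pverts ?G" for u
  proof -
    have sA: "sum f A = s" and sB: "sum f B = m * y" and sC: "sum f C = t * z"
      using fA fB fC card by simp_all
    have u': "u \<in> A \<union> B \<union> C" using u V by simp
    consider "u \<in> A" | "u \<in> B" | "u \<in> C" using u' by auto
    then show ?thesis
    proof cases
      case 1
      have "card ((A - {u}) \<union> B \<union> C) = s - 1 + m + t"
        using 1 fin disj card by (subst card_Un_disjoint; (subst card_Un_disjoint)?) auto
      moreover have "sum f ((A - {u}) \<union> B \<union> C) = s - 1 + m * y + t * z"
        using 1 fin disj sA sB sC fA[OF 1] assms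
        by (subst sum.union_disjoint; (subst sum.union_disjoint)?) (auto simp: sum_diff1 of_nat_diff)
      moreover have "real (s - 1 + m + t) = real s + real m + real t - 1"
        using assms by (simp add: of_nat_diff)
      ultimately show ?thesis
        unfolding nbV[OF u'] vdegree_eq_card nb[OF u'] using 1 k(2) fA[OF 1] by simp
    next
      case 2
      then have nA: "u \<notin> A" using disj by auto
      have "card (A \<union> (B - {u})) = s + (m - 1)"
        using 2 fin disj card by (subst card_Un_disjoint) auto
      moreover have "real (s + (m - 1)) = real m + real s - 1"
        using assms by (simp add: of_nat_diff)
      moreover have "sum f (A \<union> (B - {u})) = real s + (real m - 1) * y"
        using 2 fin disj sA sB fB[OF 2] assms
        by (subst sum.union_disjoint) (auto simp: sum_diff1 of_nat_diff algebra_simps)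
      ultimately show ?thesis
        unfolding nbV[OF u'] vdegree_eq_card nb[OF u'] using 2 nA k(3) fB[OF 2]
        by (simp add: add.commute)
    next
      case 3
      then have nA: "u \<notin> A" "u \<notin> B" using disj by auto
      show ?thesis
        unfolding nbV[OF u'] vdegree_eq_card nb[OF u'] using 3 nA k(4) fC[OF 3] card sA
        by (simp add: algebra_simps)
    qed
  qed
  have "finite (pverts ?G)" using V fin by simp
  note xs = vertex_enum[OF this]
  have "Inl 0 \<in> pverts ?G" "f (Inl 0) \<noteq> 0" using V assms by (auto simp: A_def f_def)
  then have "k \<in> spectrum (A_alpha \<alpha> (vertex_enum ?G) ?G)"
    unfolding A_alpha_spectrum[OF xs] using eq by blast
  then have "k \<le> rho_alpha \<alpha> ?G"
    unfolding rho_alpha_def using card_finite_spectrum(1)[OF A_alpha_carrier] by (intro Max_ge)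
  then show ?thesis using k(1) by simp
qed

section \<open>Comparison of the two radius bounds\<close>

theorem theorem1p1:
  fixes \<alpha> :: real and G :: "'a pair_pre_digraph" and n \<delta> :: nat
  assumes "0 \<le> \<alpha>" and "\<alpha> < 1"
    and "pair_graph G" and "Digraph_Component.connected (with_proj G)"
    and "\<delta> = min_degree G" and "\<delta> \<ge> 2"
    and "n = card (pverts G)" and "even n"
    and "real n \<ge> (if \<alpha> \<le> 1 / 2 then 7 * real \<delta> - 7
                   else if \<alpha> \<le> 2 / 3 then 8 * real \<delta> - 8
                   else (3 * real \<delta> - 3) / (1 - \<alpha>))"
    and "rho_alpha \<alpha> G \<ge> rho_alpha \<alpha>
           (graph_join (complete_graph \<delta>)
             (disjoint_union (complete_graph (n - 2 * \<delta> + 1))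
               (copies (\<delta> - 1) (complete_graph 1))))"
  shows "(\<exists>F. even_factor F G) \<or>
         digraph_iso (with_proj G)
           (with_proj (graph_join (complete_graph \<delta>)
             (disjoint_union (complete_graph (n - 2 * \<delta> + 1))
               (copies (\<delta> - 1) (complete_graph 1)))))"
proof -
  have \<delta>2: "real \<delta> \<ge> 2" using \<open>\<delta> \<ge> 2\<close> by simp
  \<comment> \<open>The first bound is the weakest: for \<open>\<alpha> > 2 / 3\<close> the divisor
    is below 1/3, so the third bound is at least \<open>9 * \<delta> - 9\<close>.\<close>
  have "real n \<ge> 7 * real \<delta> - 7"
  proof (cases "\<alpha> \<le> 2 / 3")
    case True
    then show ?thesis using assms(9) \<delta>2 by (auto split: if_splits)
  next
    case False
    then have "(3 * real \<delta> - 3) / (1 / 3) \<le> (3 * real \<delta> - 3) / (1 - \<alpha>)"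
      using \<delta>2 \<open>\<alpha> < 1\<close> by (intro divide_left_mono) auto
    then show ?thesis using False assms(9) \<delta>2 by simp
  qed
  \<comment> \<open>This makes the natural-number subtraction in \<open>n - 2 * \<delta> + 1\<close>
    exact, so the clique on \<open>m + s\<close> vertices has order
    \<open>n - \<delta> + 1\<close>.\<close>
  then have n: "2 * \<delta> \<le> n" using \<delta>2 by linarith
  have "rho_alpha \<alpha> G > real (n - 2 * \<delta> + 1) + real \<delta> - 1"
    using rho_alpha_join_gt[of \<alpha> \<delta> "n - 2 * \<delta> + 1" "\<delta> - 1"] assms by force
  then have rho: "rho_alpha \<alpha> G > real n - real \<delta>" using n by (simp add: of_nat_diff)
  note Ga = pair_graph_arcs[OF \<open>pair_graph G\<close>]
  have "pverts G \<noteq> {}" using n \<open>\<delta> \<ge> 2\<close> \<open>n = card (pverts G)\<close> by auto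
  then obtain v where v: "v \<in> pverts G" "rho_alpha \<alpha> G \<le> vdegree G v"
    using rho_alpha_le_degree[of \<alpha> G] assms(1-3) by auto
  have "\<delta> \<le> vdegree G u" if "u \<in> pverts G" for u
    using that Ga(1) \<open>\<delta> = min_degree G\<close> by (auto simp: min_degree_def intro: Min_le)
  \<comment> \<open>The degree of \<open>v\<close> is at least the radius, which exceeds
    \<open>n - \<delta>\<close>.\<close>
  moreover have "card (pverts G) < vdegree G v + \<delta>"
    using rho v(2) \<open>n = card (pverts G)\<close> by linarith
  ultimately show ?thesis
    using even_factor_of_large_degree[OF \<open>pair_graph G\<close> v(1)] by blast
qed

end
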